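(* Let $G$ be a finite directed weighted graph on nodes $\{1,\dots,n\}$ without loops with positive edge weights and adjacency matrix $A$, whose $m$ edges are labelled $1,\dots,m$, with source and target matrices $L,R\in\mathbb{R}^{m\times n}$, edge-weight matrix $Z$ and weighted Hashimoto matrix $B$; let $V=B^{\circ 1/2}$ and let $\rho(V)$ be its spectral radius. Let $p_k(A)$ be the matrix whose $(i,j)$ entry is the sum of the weights of all nonbacktracking walks of length $k$ from $i$ to $j$, with $p_0(A)=I$. Let $(c_k)_{k\ge 0}\subset[0,\infty)$, let $f(x)=\sum_{k=0}^\infty c_k x^k$ have radius of convergence $r$, and let $\partial f(x)=\sum_{k=0}^\infty c_{k+1}x^k$. Then for $|t|<r/\rho(V)$, \[ \sum_{k=0}^\infty c_k t^k p_k(A) = c_0 I + t\, L^T\sqrt{Z}\,\partial f(tV)\,\sqrt{Z}\,R, \] and consequently the vector $\boldsymbol{v}(t,A)=\bigl(\sum_{k=0}^\infty c_k t^k p_k(A)\bigr)\mathbf{1}$ satisfies \[ \boldsymbol{v}(t,A) = c_0\mathbf{1} + t\, L^T\sqrt{Z}\,\partial f(tV)\,\sqrt{Z}\,\mathbf{1}. \]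
   Context: $L_{ej}=1$ if edge $e$ starts at node $j$, else $0$; $R_{ej}=1$ if edge $e$ ends at node $j$, else $0$. $Z$ is the $m\times m$ diagonal matrix with $Z_{ee}=A_{ij}$ when edge $e$ is $(i,j)$. $W_{ef}=A_{ij}A_{jk}$ if $e=(i,j)$ and $f=(j,k)$, else $0$; $B_{ef}=0$ if $W_{ef}W_{fe}\ne 0$ and $B_{ef}=W_{ef}$ otherwise. $B^{\circ 1/2}$ is the elementwise square root. For a square matrix $X$, $\partial f(X)=\sum_{k\ge0}c_{k+1}X^k$. A walk (node sequence with consecutive pairs being edges) has weight equal to the product of its edge weights and is nonbacktracking if it contains no consecutive subsequence $i\,j\,i$. $\mathbf{1}$ is the all-ones vector. *)

theory Defs
  imports
    "HOL-Analysis.Summation_Tests"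
    "HOL-Library.Sublist"
    "Jordan_Normal_Form.Spectral_Radius"
    "Graph_Theory.Vertex_Walk"
begin

text \<open>
  A graph on \<open>n\<close> nodes with \<open>m\<close> labelled edges is a \<^typ>\<open>(nat, nat) pre_digraph\<close> with
  \<open>verts G = {..<n}\<close> and \<open>arcs G = {..<m}\<close>. Nodes and edges are numbered from 0, as are the
  rows and columns of matrices. The weight of an edge is the corresponding entry of the
  adjacency matrix.
\<close>

definition source_mat :: "(nat, nat) pre_digraph \<Rightarrow> real mat" where
  "source_mat G = Matrix.mat (card (arcs G)) (card (verts G))
     (\<lambda>(e, j). if tail G e = j then 1 else 0)"

definition target_mat :: "(nat, nat) pre_digraph \<Rightarrow> real mat" where
  "target_mat G = Matrix.mat (card (arcs G)) (card (verts G))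
     (\<lambda>(e, j). if head G e = j then 1 else 0)"

definition edge_weight_mat :: "(nat, nat) pre_digraph \<Rightarrow> real mat \<Rightarrow> real mat" where
  "edge_weight_mat G A = Matrix.mat (card (arcs G)) (card (arcs G))
     (\<lambda>(e, f). if e = f then A $$ (tail G e, head G e) else 0)"

definition line_graph_mat :: "(nat, nat) pre_digraph \<Rightarrow> real mat \<Rightarrow> real mat" where
  "line_graph_mat G A = Matrix.mat (card (arcs G)) (card (arcs G))
     (\<lambda>(e, f). if head G e = tail G f
               then A $$ (tail G e, head G e) * A $$ (tail G f, head G f) else 0)"

definition hashimoto_mat :: "(nat, nat) pre_digraph \<Rightarrow> real mat \<Rightarrow> real mat" where
  "hashimoto_mat G A = Matrix.mat (card (arcs G)) (card (arcs G))
     (\<lambda>(e, f). if line_graph_mat G A $$ (e, f) * line_graph_mat G A $$ (f, e) \<noteq> 0 then 0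
               else line_graph_mat G A $$ (e, f))"

text \<open>
  Elementwise square root. For a diagonal matrix with nonnegative entries it is also the
  principal matrix square root.
\<close>

definition sqrt_mat :: "real mat \<Rightarrow> real mat" where
  "sqrt_mat X = map_mat sqrt X"

text \<open>
  The library's spectral radius is for complex matrices and is a maximum over the spectrum,
  hence unspecified for the \<open>0 \<times> 0\<close> matrix, which arises here from a graph without edges.
\<close>

definition real_spectral_radius :: "real mat \<Rightarrow> real" where
  "real_spectral_radius X =
     (if dim_row X = 0 then 0 else spectral_radius (map_mat complex_of_real X))"

definition nonbacktracking :: "'v list \<Rightarrow> bool" where
  "nonbacktracking p \<longleftrightarrow> \<not> (\<exists>i j. sublist [i, j, i] p)"

definition walk_weight :: "real mat \<Rightarrow> nat list \<Rightarrow> real" where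
  "walk_weight A p = prod_list (map (\<lambda>(i, j). A $$ (i, j)) (vwalk_arcs p))"

definition nbt_walks :: "('v, 'e) pre_digraph \<Rightarrow> nat \<Rightarrow> 'v \<Rightarrow> 'v \<Rightarrow> 'v list set" where
  "nbt_walks G k i j =
     {p. vwalk p G \<and> nonbacktracking p \<and> vwalk_length p = k \<and> hd p = i \<and> last p = j}"

definition nbt_walk_mat :: "(nat, nat) pre_digraph \<Rightarrow> real mat \<Rightarrow> nat \<Rightarrow> real mat" where
  "nbt_walk_mat G A k = Matrix.mat (card (verts G)) (card (verts G))
     (\<lambda>(i, j). \<Sum>p\<in>nbt_walks G k i j. walk_weight A p)"

lemma finite_nbt_walks:
  assumes "finite (verts G)"
  shows "finite (nbt_walks G k i j)"
proof (rule finite_subset)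
  show "nbt_walks G k i j \<subseteq> {p. set p \<subseteq> verts G \<and> length p \<le> Suc k}"
    by (auto simp: nbt_walks_def vwalk_def)
  show "finite {p. set p \<subseteq> verts G \<and> length p \<le> Suc k}"
    using assms by (rule finite_lists_length_le)
qed

lemma nbt_walk_mat_0:
  assumes "verts G = {..<n}"
  shows "nbt_walk_mat G A 0 = 1\<^sub>m n"
proof (rule eq_matI)
  fix i j assume ij: "i < dim_row (1\<^sub>m n :: real mat)" "j < dim_col (1\<^sub>m n :: real mat)"
  have "nbt_walks G 0 i j = (if i = j then {[i]} else {})"
  proof (intro equalityI subsetI)
    fix p assume p: "p \<in> nbt_walks G 0 i j"
    then obtain x where "p = [x]"
      by (cases p) (auto simp: nbt_walks_def vwalk_def)
    with p show "p \<in> (if i = j then {[i]} else {})"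
      by (auto simp: nbt_walks_def)
  next
    fix p assume "p \<in> (if i = j then {[i]} else {})"
    with ij assms show "p \<in> nbt_walks G 0 i j"
      by (auto simp: nbt_walks_def vwalk_def nonbacktracking_def sublist_Cons_right
          split: if_splits)
  qed
  with ij assms show "nbt_walk_mat G A 0 $$ (i, j) = 1\<^sub>m n $$ (i, j)"
    by (simp add: nbt_walk_mat_def walk_weight_def)
qed (use assms in \<open>simp_all add: nbt_walk_mat_def\<close>)

text \<open>Convergence and limit of a series of matrices of fixed size are taken entrywise.\<close>

definition mat_summable :: "nat \<Rightarrow> nat \<Rightarrow> (nat \<Rightarrow> 'a::real_normed_field mat) \<Rightarrow> bool" where
  "mat_summable nr nc F \<longleftrightarrow> (\<forall>i<nr. \<forall>j<nc. summable (\<lambda>k. F k $$ (i, j)))"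

definition mat_suminf :: "nat \<Rightarrow> nat \<Rightarrow> (nat \<Rightarrow> 'a::real_normed_field mat) \<Rightarrow> 'a mat" where
  "mat_suminf nr nc F = Matrix.mat nr nc (\<lambda>(i, j). \<Sum>k. F k $$ (i, j))"

text \<open>The function \<open>\<partial>f\<close> of a square matrix, for \<open>f(x) = \<Sum>k. c k * x ^ k\<close>.\<close>

definition shifted_terms :: "(nat \<Rightarrow> real) \<Rightarrow> 'a::real_normed_field mat \<Rightarrow> nat \<Rightarrow> 'a mat" where
  "shifted_terms c X k = of_real (c (Suc k)) \<cdot>\<^sub>m (X ^\<^sub>m k)"

definition shifted_fun :: "(nat \<Rightarrow> real) \<Rightarrow> 'a::real_normed_field mat \<Rightarrow> 'a mat" where
  "shifted_fun c X = mat_suminf (dim_row X) (dim_row X) (shifted_terms c X)"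

definition nbt_terms ::
  "(nat, nat) pre_digraph \<Rightarrow> real mat \<Rightarrow> (nat \<Rightarrow> real) \<Rightarrow> 'a::real_normed_field \<Rightarrow> nat \<Rightarrow> 'a mat" where
  "nbt_terms G A c t k = (of_real (c k) * t ^ k) \<cdot>\<^sub>m map_mat of_real (nbt_walk_mat G A k)"

definition ones_vec :: "nat \<Rightarrow> 'a::one Matrix.vec" where
  "ones_vec n = Matrix.vec n (\<lambda>_. 1)"

definition nbt_centrality ::
  "(nat, nat) pre_digraph \<Rightarrow> real mat \<Rightarrow> (nat \<Rightarrow> real) \<Rightarrow> 'a::real_normed_field \<Rightarrow> 'a Matrix.vec" where
  "nbt_centrality G A c t =
     mat_suminf (card (verts G)) (card (verts G)) (nbt_terms G A c t)
       *\<^sub>v ones_vec (card (verts G))"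

end

theory Submission
  imports Defs
begin

text \<open>
  A nonbacktracking walk of length \<open>k + 1\<close> is a sequence of \<open>k + 1\<close> edges in which every
  consecutive pair is a nonzero entry of \<open>V\<close>. Along such a sequence every inner edge weight
  contributes its square root to two factors of \<open>V\<close>, and the two outer \<open>\<surd>Z\<close> supply the missing
  square roots of the first and last weight. Hence \<open>p\<^sub>k\<^sub>+\<^sub>1(A) = L\<^sup>T \<surd>Z V\<^sup>k \<surd>Z R\<close>, and the claim is
  obtained by summing over \<open>k\<close>. For the convergence choose \<open>x\<close> with \<open>|t| \<rho>(V) < x < r\<close>: the
  matrix \<open>(|t|/x) V\<close> has spectral radius below 1, so its powers are bounded, and the entries of
  \<open>(tV)\<^sup>k\<close> are \<open>O(x\<^sup>k)\<close>. This also covers \<open>\<rho>(V) = 0\<close>.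
\<close>

section \<open>Matrix products and powers\<close>

lemma index_mult_mat_sum:
  assumes "X \<in> carrier_mat nr n" "Y \<in> carrier_mat n nc" "i < nr" "j < nc"
  shows "(X * Y) $$ (i, j) = (\<Sum>k<n. X $$ (i, k) * Y $$ (k, j))"
  using assms by (auto simp: scalar_prod_def atLeast0LessThan intro!: sum.cong)

lemma pow_mat_Suc_left:
  assumes "X \<in> carrier_mat n n"
  shows "X ^\<^sub>m Suc k = X * X ^\<^sub>m k"
proof (induction k)
  case (Suc k)
  have "X ^\<^sub>m Suc (Suc k) = (X * X ^\<^sub>m k) * X"
    using Suc by simp
  also have "\<dots> = X * X ^\<^sub>m Suc k"
    using assms by (simp add: assoc_mult_mat[of _ n n _ n _ n])
  finally show ?case .
qed (use assms in simp)

lemma smult_pow_mat: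
  fixes X :: "'a::comm_semiring_1 mat"
  assumes X: "X \<in> carrier_mat n n"
  shows "(a \<cdot>\<^sub>m X) ^\<^sub>m k = a ^ k \<cdot>\<^sub>m X ^\<^sub>m k"
proof (induction k)
  case 0
  show ?case by (rule eq_matI) auto
next
  case (Suc k)
  have "(a \<cdot>\<^sub>m X) ^\<^sub>m Suc k = (a ^ k \<cdot>\<^sub>m X ^\<^sub>m k) * (a \<cdot>\<^sub>m X)"
    using Suc by simp
  also have "\<dots> = a ^ k \<cdot>\<^sub>m (a \<cdot>\<^sub>m (X ^\<^sub>m k * X))"
    using X by (subst mult_smult_assoc_mat[of _ n n _ n], simp, simp)
      (subst mult_smult_distrib[of _ n n _ n], auto)
  finally show ?case
    using X by (intro eq_matI) (auto simp: mult_ac)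
qed

section \<open>Spectral radius and growth of powers\<close>

lemma spectral_radius_nonneg:
  assumes "X \<in> carrier_mat n n" "n > 0"
  shows "spectral_radius X \<ge> 0"
  using spectral_radius_mem_max(1)[OF assms] by auto

lemma real_spectral_radius_nonneg:
  assumes "X \<in> carrier_mat n n"
  shows "real_spectral_radius X \<ge> 0"
  using assms spectral_radius_nonneg[of "map_mat complex_of_real X" n]
  by (auto simp: real_spectral_radius_def)

text \<open>For nonzero \<open>a\<close>, dividing an eigenvalue of
  \<open>a \<cdot>\<^sub>m X\<close> of maximal modulus by \<open>a\<close> gives an eigenvalue of
  \<open>X\<close> with the same eigenvector.\<close>

lemma spectral_radius_smult_le:
  assumes X: "X \<in> carrier_mat n n" and n: "n > 0"
  shows "spectral_radius (a \<cdot>\<^sub>m X) \<le> norm a * spectral_radius X"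
proof -
  have aX: "a \<cdot>\<^sub>m X \<in> carrier_mat n n"
    using X by simp
  obtain l where l: "eigenvalue (a \<cdot>\<^sub>m X) l" and eq: "spectral_radius (a \<cdot>\<^sub>m X) = norm l"
    using spectral_radius_mem_max(1)[OF aX n] by (auto simp: spectrum_def)
  obtain v where v: "v \<in> carrier_vec n" "v \<noteq> 0\<^sub>v n" "(a \<cdot>\<^sub>m X) *\<^sub>v v = l \<cdot>\<^sub>v v"
    using l aX by (auto simp: eigenvalue_def eigenvector_def)
  have av: "a \<cdot>\<^sub>v (X *\<^sub>v v) = l \<cdot>\<^sub>v v"
    unfolding v(3)[symmetric] using X v(1) by (intro eq_vecI) auto
  show ?thesis
  proof (cases "a = 0")
    case True
    \<comment> \<open>The eigenvalue equation now says that \<open>l\<close> times \<open>v\<close>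
      is zero, and a nonzero coordinate of \<open>v\<close> forces \<open>l = 0\<close>.\<close>
    obtain i where i: "i < n" "v $ i \<noteq> 0"
      using v(1,2) by (metis carrier_vecD eq_vecI index_zero_vec(1) index_zero_vec(2))
    have "l * v $ i = 0"
      using arg_cong[OF av, of "\<lambda>u. u $ i"] True X v(1) i by auto
    then show ?thesis
      using i eq True by simp
  next
    case False
    have "(l / a) \<cdot>\<^sub>v v = (1 / a) \<cdot>\<^sub>v (a \<cdot>\<^sub>v (X *\<^sub>v v))"
      unfolding av by (simp add: smult_smult_assoc)
    also have "\<dots> = X *\<^sub>v v"
      using False by (simp add: smult_smult_assoc)
    finally have "eigenvalue X (l / a)"
      using v X by (auto simp: eigenvalue_def eigenvector_def)
    then have "norm (l / a) \<le> spectral_radius X"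
      by (intro spectral_radius_mem_max(2)[OF X n]) (simp add: spectrum_def)
    then show ?thesis
      using False eq by (simp add: norm_divide field_simps)
  qed
qed

text \<open>The powers of \<open>X\<close> scaled by \<open>a / x\<close> are bounded; multiplying
  through by \<open>x ^ k\<close> gives this form. It never divides by the spectral radius, so
  nilpotent \<open>X\<close> is included.\<close>

lemma pow_mat_entries_bound:
  fixes X :: "real mat"
  assumes X: "X \<in> carrier_mat n n" and a: "a \<ge> 0" and x: "a * real_spectral_radius X < x"
  obtains C where
    "\<And>i j k. i < n \<Longrightarrow> j < n \<Longrightarrow> a ^ k * \<bar>(X ^\<^sub>m k) $$ (i, j)\<bar> \<le> C * x ^ k"
proof (cases "n = 0")
  case True
  then show ?thesis using that by simp
next
  case False
  define Y where "Y = map_mat complex_of_real X"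
  have Y: "Y \<in> carrier_mat n n"
    using X by (simp add: Y_def)
  have rho: "real_spectral_radius X = spectral_radius Y"
    using False X by (simp add: real_spectral_radius_def Y_def)
  have x0: "x > 0"
    using x a real_spectral_radius_nonneg[OF X] by (meson le_less_trans mult_nonneg_nonneg)
  let ?Y = "complex_of_real (a / x) \<cdot>\<^sub>m Y"
  have "spectral_radius ?Y \<le> norm (complex_of_real (a / x)) * spectral_radius Y"
    using False by (intro spectral_radius_smult_le[OF Y]) simp
  also have "\<dots> < 1"
    using x a x0 by (simp add: rho norm_divide)
  \<comment> \<open>Strictness matters: at spectral radius exactly 1, nontrivial Jordan blocks could
    make the powers grow polynomially.\<close>
  finally obtain C where C: "\<And>k. norm_bound (?Y ^\<^sub>m k) C"
    using spectral_radius_jnf_norm_bound_less_1_upper_triangular[of ?Y n] Y by auto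
  show ?thesis
  proof
    fix i j k assume ij: "i < n" "j < n"
    have "?Y ^\<^sub>m k = complex_of_real ((a / x) ^ k) \<cdot>\<^sub>m map_mat complex_of_real (X ^\<^sub>m k)"
      unfolding smult_pow_mat[OF Y] by (simp add: Y_def of_real_hom.mat_hom_pow[OF X])
    then have "norm ((?Y ^\<^sub>m k) $$ (i, j)) = (a / x) ^ k * \<bar>(X ^\<^sub>m k) $$ (i, j)\<bar>"
      using ij X a x0 by (simp add: norm_mult norm_power norm_divide)
    moreover have "norm ((?Y ^\<^sub>m k) $$ (i, j)) \<le> C"
      using C[of k] ij Y by (simp add: norm_bound_def)
    ultimately have "(a / x) ^ k * \<bar>(X ^\<^sub>m k) $$ (i, j)\<bar> \<le> C"
      by simp
    then show "a ^ k * \<bar>(X ^\<^sub>m k) $$ (i, j)\<bar> \<le> C * x ^ k"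
      using x0 by (simp add: power_divide field_simps)
  qed
qed

section \<open>Convergence of the matrix power series\<close>

text \<open>The bound on powers reduces every entry to the scalar series of \<open>c\<close> inside
  its radius of convergence. Completeness of \<open>'a\<close> turns absolute convergence into
  convergence.\<close>

lemma mat_summable_shifted_terms:
  fixes X :: "real mat" and t :: "'a::{real_normed_field, banach}"
  assumes X: "X \<in> carrier_mat n n"
    and t: "ereal (norm t) < conv_radius c / ereal (real_spectral_radius X)"
  shows "mat_summable n n (shifted_terms c (t \<cdot>\<^sub>m map_mat of_real X))"
  unfolding mat_summable_def
proof (intro allI impI)
  fix i j assume ij: "i < n" "j < n"
  let ?\<rho> = "real_spectral_radius X"
  have \<rho>: "?\<rho> \<ge> 0"
    using real_spectral_radius_nonneg[OF X] .
  \<comment> \<open>In \<open>ereal\<close>, a positive number divided by 0 is infinite and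
    \<open>0 / 0 = 0\<close>. So for \<open>?\<rho> = 0\<close> the hypothesis still says that the
    radius of convergence is positive, which is what the product form then asserts.\<close>
  have "ereal (norm t * ?\<rho>) < conv_radius c"
  proof (cases "?\<rho> = 0")
    case True
    have "conv_radius c \<noteq> 0"
      using t by auto
    then show ?thesis
      using True conv_radius_nonneg[of c] by (simp add: zero_ereal_def[symmetric])
  next
    case False
    then show ?thesis
      using t \<rho> by (simp add: ereal_less_divide_iff)
  qed
  \<comment> \<open>Such an \<open>x\<close> has room on both sides: it dominates the growth of the
    powers and still lies in the region of absolute convergence.\<close>
  then obtain x where x: "norm t * ?\<rho> < x" "ereal x < conv_radius c"
    using ereal_dense2 by fastforce
  have x0: "x > 0"
    using x(1) \<rho> by (meson le_less_trans mult_nonneg_nonneg norm_ge_zero)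
  obtain C where C: "\<And>i j k. i < n \<Longrightarrow> j < n \<Longrightarrow>
      norm t ^ k * \<bar>(X ^\<^sub>m k) $$ (i, j)\<bar> \<le> C * x ^ k"
    using pow_mat_entries_bound[OF X norm_ge_zero x(1)] by blast
  have "summable (\<lambda>k. norm (c k * x ^ k))"
    using x(2) x0 by (intro abs_summable_in_conv_radius) simp
  \<comment> \<open>The coefficient \<open>c (Suc k)\<close> meets only \<open>x ^ k\<close>, so the
    majorant is the series at \<open>x\<close>, shifted by one index and divided by
    \<open>x\<close>.\<close>
  then have "summable (\<lambda>k. C / x * norm (c (Suc k) * x ^ Suc k))"
    by (intro summable_mult) (rule summable_Suc_iff[THEN iffD2])
  then show "summable (\<lambda>k. shifted_terms c (t \<cdot>\<^sub>m map_mat of_real X) k $$ (i, j))"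
  proof (rule summable_comparison_test'[where N = 0])
    fix k
    have "shifted_terms c (t \<cdot>\<^sub>m map_mat of_real X) k $$ (i, j)
        = of_real (c (Suc k)) * (t ^ k * of_real ((X ^\<^sub>m k) $$ (i, j)))"
      using ij X by (simp add: shifted_terms_def smult_pow_mat[of _ n]
          of_real_hom.mat_hom_pow[OF X, symmetric])
    then have "norm (shifted_terms c (t \<cdot>\<^sub>m map_mat of_real X) k $$ (i, j))
        = \<bar>c (Suc k)\<bar> * (norm t ^ k * \<bar>(X ^\<^sub>m k) $$ (i, j)\<bar>)"
      by (simp add: norm_mult norm_power)
    also have "\<dots> \<le> \<bar>c (Suc k)\<bar> * (C * x ^ k)"
      using C[OF ij] by (intro mult_left_mono) auto
    also have "\<dots> = C / x * norm (c (Suc k) * x ^ Suc k)"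
      using x0 by (simp add: abs_mult)
    finally show "norm (shifted_terms c (t \<cdot>\<^sub>m map_mat of_real X) k $$ (i, j))
        \<le> C / x * norm (c (Suc k) * x ^ Suc k)" .
  qed
qed

text \<open>Each entry of \<open>P * F k * Q\<close> is a finite linear combination of entries of
  \<open>F k\<close> with coefficients independent of \<open>k\<close>, so the limit can be taken
  termwise.\<close>

lemma sums_mat_suminf_sandwich:
  assumes P: "P \<in> carrier_mat nr m" and Q: "Q \<in> carrier_mat m nc"
    and F: "\<And>k. F k \<in> carrier_mat m m" and sm: "mat_summable m m F"
    and ij: "i < nr" "j < nc"
  shows "(\<lambda>k. (P * F k * Q) $$ (i, j)) sums (P * mat_suminf m m F * Q) $$ (i, j)"
proof -
  have expand: "(P * X * Q) $$ (i, j) = (\<Sum>f<m. (\<Sum>e<m. P $$ (i, e) * X $$ (e, f)) * Q $$ (f, j))"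
    if X: "X \<in> carrier_mat m m" for X
    using index_mult_mat_sum[of "P * X" nr m Q nc i j] index_mult_mat_sum[OF P X ij(1)] P Q X ij
    by (simp del: index_mult_mat(1))
  have "(\<lambda>k. F k $$ (e, f)) sums mat_suminf m m F $$ (e, f)" if "e < m" "f < m" for e f
    using sm that by (auto simp: mat_summable_def mat_suminf_def summable_sums)
  then show ?thesis
    unfolding expand[OF F] by (subst expand) (auto simp: mat_suminf_def intro!: sums_sum sums_mult sums_mult2)
qed

section \<open>Nonbacktracking walks sorted by first edge\<close>

text \<open>A forbidden pattern in \<open>x # p\<close> either lies within \<open>p\<close> or
  starts at \<open>x\<close>.\<close>

lemma nonbacktracking_Cons:
  "nonbacktracking (x # p) \<longleftrightarrow> nonbacktracking p \<and> \<not> (\<exists>y. prefix [y, x] p)"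
  by (auto simp: nonbacktracking_def sublist_Cons_right)

text \<open>Walks of length \<open>k + 1\<close> whose first edge is \<open>e\<close>; the offset mirrors the exponent of \<open>V\<close>.\<close>

definition nbt_walks_via :: "('v, 'e) pre_digraph \<Rightarrow> nat \<Rightarrow> 'e \<Rightarrow> 'v \<Rightarrow> 'v list set" where
  "nbt_walks_via G k e j = {p \<in> nbt_walks G (Suc k) (tail G e) j. p ! 1 = head G e}"

text \<open>Exposes the first two nodes. A walk of length \<open>Suc k\<close> has
  \<open>k + 2\<close> nodes, which leaves \<open>k\<close> for \<open>q\<close>.\<close>

lemma in_nbt_walks_via_iff:
  "p \<in> nbt_walks_via G k e j \<longleftrightarrow>
     (\<exists>q. p = tail G e # head G e # q \<and> vwalk p G \<and> nonbacktracking p \<and> length q = k \<and> last p = j)"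
  by (cases p; cases "tl p") (auto simp: nbt_walks_via_def nbt_walks_def)

context digraph
begin

text \<open>Walks are node lists, whereas the matrices are indexed by edges; the absence of parallel
  edges lets a walk determine its edges.\<close>

lemma arc_eqI:
  "e \<in> arcs G \<Longrightarrow> f \<in> arcs G \<Longrightarrow> tail G e = tail G f \<Longrightarrow> head G e = head G f \<Longrightarrow> e = f"
  using no_multi_arcs by (auto simp: arc_to_ends_def)

lemma finite_nbt_walks_via: "finite (nbt_walks_via G k e j)"
  by (simp add: nbt_walks_via_def finite_nbt_walks)

lemma nbt_walks_via_disjoint:
  assumes "e \<in> arcs G" "f \<in> arcs G" "e \<noteq> f"
  shows "nbt_walks_via G k e i \<inter> nbt_walks_via G l f j = {}"
  using assms arc_eqI by (auto simp: in_nbt_walks_via_iff)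

lemma nbt_walks_Suc:
  "nbt_walks G (Suc k) i j = (\<Union>e\<in>{e \<in> arcs G. tail G e = i}. nbt_walks_via G k e j)"
proof (intro equalityI subsetI)
  fix p assume p: "p \<in> nbt_walks G (Suc k) i j"
  then obtain y q where pq: "p = i # y # q"
    by (cases p; cases "tl p") (auto simp: nbt_walks_def)
  then have "(i, y) \<in> arcs_ends G"
    using p by (auto simp: nbt_walks_def vwalk_def)
  then obtain e where "e \<in> arcs G" "tail G e = i" "head G e = y"
    by (auto simp: arcs_ends_conv)
  then show "p \<in> (\<Union>e\<in>{e \<in> arcs G. tail G e = i}. nbt_walks_via G k e j)"
    using p pq by (auto simp: nbt_walks_via_def)
qed (auto simp: nbt_walks_via_def)

lemma nbt_walks_via_0:
  assumes "e \<in> arcs G"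
  shows "nbt_walks_via G 0 e j = (if head G e = j then {[tail G e, head G e]} else {})"
  using assms
  by (auto simp: in_nbt_walks_via_iff vwalk_def nonbacktracking_def arcs_ends_conv sublist_Cons_right)

text \<open>Dropping the first node leaves a walk through the next edge \<open>f\<close>. The only
  pattern lost with it is the one on the first three nodes, which is excluded by
  \<open>head G f \<noteq> tail G e\<close>.\<close>

lemma nbt_walks_via_Suc:
  assumes e: "e \<in> arcs G"
  shows "nbt_walks_via G (Suc k) e j =
    (\<Union>f\<in>{f \<in> arcs G. head G e = tail G f \<and> head G f \<noteq> tail G e}.
       (#) (tail G e) ` nbt_walks_via G k f j)"
proof (intro equalityI subsetI)
  fix p assume p: "p \<in> nbt_walks_via G (Suc k) e j"
  then obtain z q where pq: "p = tail G e # head G e # z # q"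
    by (auto simp: in_nbt_walks_via_iff length_Suc_conv)
  then have "(head G e, z) \<in> arcs_ends G"
    using p by (auto simp: in_nbt_walks_via_iff vwalk_def)
  then obtain f where f: "f \<in> arcs G" "tail G f = head G e" "head G f = z"
    by (auto simp: arcs_ends_conv)
  have "tl p \<in> nbt_walks_via G k f j" "z \<noteq> tail G e"
    using p pq f by (auto simp: in_nbt_walks_via_iff vwalk_def nonbacktracking_Cons)
  then show "p \<in> (\<Union>f\<in>{f \<in> arcs G. head G e = tail G f \<and> head G f \<noteq> tail G e}.
      (#) (tail G e) ` nbt_walks_via G k f j)"
    using f pq by (auto intro!: image_eqI[of _ _ "tl p"])
next
  fix p assume "p \<in> (\<Union>f\<in>{f \<in> arcs G. head G e = tail G f \<and> head G f \<noteq> tail G e}.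
      (#) (tail G e) ` nbt_walks_via G k f j)"
  then obtain f q where f: "f \<in> arcs G" "head G e = tail G f" "head G f \<noteq> tail G e"
    and p: "p = tail G e # q" and q: "q \<in> nbt_walks_via G k f j"
    by auto
  have "(tail G e, tail G f) \<in> arcs_ends G" "tail G e \<in> verts G"
    using e f(2) by (auto simp: arcs_ends_conv)
  then show "p \<in> nbt_walks_via G (Suc k) e j"
    using f p q by (auto simp: in_nbt_walks_via_iff vwalk_def nonbacktracking_Cons)
qed

end

section \<open>Walk weights from powers of the transition matrix\<close>

locale weighted_digraph = digraph G for G :: "(nat, nat) pre_digraph" +
  fixes n m :: nat and A :: "real mat"
  assumes verts_eq: "verts G = {..<n}"
    and arcs_eq: "arcs G = {..<m}"
    and weight_pos: "e \<in> arcs G \<Longrightarrow> A $$ (tail G e, head G e) > 0"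
begin

abbreviation weight :: "nat \<Rightarrow> real" where
  "weight e \<equiv> A $$ (tail G e, head G e)"

text \<open>Together with \<open>transition_mat\<close>, which is \<open>V\<close>, the matrices
  \<open>left_mat\<close> and \<open>right_mat\<close> are the factors of the claim: each square
  root of \<open>Z\<close> is grouped with its neighbour.\<close>

abbreviation left_mat :: "real mat" where
  "left_mat \<equiv> (source_mat G)\<^sup>T * sqrt_mat (edge_weight_mat G A)"

abbreviation right_mat :: "real mat" where
  "right_mat \<equiv> sqrt_mat (edge_weight_mat G A) * target_mat G"

abbreviation transition_mat :: "real mat" where
  "transition_mat \<equiv> sqrt_mat (hashimoto_mat G A)"

lemma carriers [simp]:
  "source_mat G \<in> carrier_mat m n"
  "target_mat G \<in> carrier_mat m n"
  "sqrt_mat (edge_weight_mat G A) \<in> carrier_mat m m"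
  "transition_mat \<in> carrier_mat m m"
  "nbt_walk_mat G A k \<in> carrier_mat n n"
  by (simp_all add: source_mat_def target_mat_def sqrt_mat_def edge_weight_mat_def
      hashimoto_mat_def nbt_walk_mat_def verts_eq arcs_eq)

lemmas dims [simp] = carriers[THEN carrier_matD(1)] carriers[THEN carrier_matD(2)]

lemma left_right_carriers [simp]:
  "left_mat \<in> carrier_mat n m" "right_mat \<in> carrier_mat m n"
  by (auto intro!: mult_carrier_mat[of _ _ m])

lemma head_less: "e < m \<Longrightarrow> head G e < n"
  using head_in_verts[of e] by (simp add: verts_eq arcs_eq)

lemma left_mat_index:
  assumes "i < n" "e < m"
  shows "left_mat $$ (i, e) = (if tail G e = i then sqrt (weight e) else 0)"
proof -
  have "left_mat $$ (i, e) =
      (\<Sum>f<m. (if tail G f = i then 1 else 0) * (if f = e then sqrt (weight f) else 0))"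
    using assms
    by (subst index_mult_mat_sum[of _ n m _ m])
      (auto simp: source_mat_def sqrt_mat_def edge_weight_mat_def verts_eq arcs_eq intro!: sum.cong)
  also have "\<dots> = (\<Sum>f<m. if f = e then (if tail G f = i then sqrt (weight f) else 0) else 0)"
    by (intro sum.cong) auto
  finally show ?thesis
    using assms by simp
qed

lemma right_mat_index:
  assumes "e < m" "j < n"
  shows "right_mat $$ (e, j) = (if head G e = j then sqrt (weight e) else 0)"
proof -
  have "right_mat $$ (e, j) =
      (\<Sum>f<m. (if e = f then sqrt (weight e) else 0) * (if head G f = j then 1 else 0))"
    using assms
    by (subst index_mult_mat_sum[of _ m m _ n])
      (auto simp: target_mat_def sqrt_mat_def edge_weight_mat_def verts_eq arcs_eq intro!: sum.cong)
  also have "\<dots> = (\<Sum>f<m. if f = e then (if head G f = j then sqrt (weight f) else 0) else 0)"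
    by (intro sum.cong) auto
  finally show ?thesis
    using assms by simp
qed

text \<open>Since edge weights are positive, the product of the line graph entries at
  \<open>(e, f)\<close> and \<open>(f, e)\<close> is nonzero exactly when each edge starts where the
  other ends. Hence only immediate reversals are deleted.\<close>

lemma transition_mat_index:
  assumes "e < m" "f < m"
  shows "transition_mat $$ (e, f) =
    (if head G e = tail G f \<and> head G f \<noteq> tail G e then sqrt (weight e) * sqrt (weight f) else 0)"
  using assms weight_pos[of e] weight_pos[of f]
  by (auto simp: sqrt_mat_def hashimoto_mat_def line_graph_mat_def arcs_eq real_sqrt_mult)

text \<open>
  The factor \<open>sqrt (weight e)\<close> completes the weight of the first edge, so that no division by
  it is needed in the induction.
\<close>

lemma transition_pow_mult_right_mat:
  assumes "e < m" "j < n"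
  shows "sqrt (weight e) * (transition_mat ^\<^sub>m k * right_mat) $$ (e, j) =
    (\<Sum>p\<in>nbt_walks_via G k e j. walk_weight A p)"
  using assms(1)
proof (induction k arbitrary: e)
  case 0
  have "transition_mat ^\<^sub>m 0 * right_mat = right_mat"
    using left_mult_one_mat[OF left_right_carriers(2)] by simp
  then show ?case
    using 0 assms(2) weight_pos[of e] right_mat_index[OF 0 assms(2)] nbt_walks_via_0[of e j]
    by (auto simp: arcs_eq walk_weight_def simp del: index_mult_mat(1))
next
  case (Suc k)
  let ?X = "transition_mat ^\<^sub>m k * right_mat"
  let ?S = "{f \<in> arcs G. head G e = tail G f \<and> head G f \<noteq> tail G e}"
  have e: "e \<in> arcs G"
    using Suc.prems by (simp add: arcs_eq)
  have X: "?X \<in> carrier_mat m n"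
    by (rule mult_carrier_mat[of _ m m]) simp_all
  have "transition_mat ^\<^sub>m Suc k * right_mat = transition_mat * ?X"
    unfolding pow_mat_Suc_left[OF carriers(4)]
    by (rule assoc_mult_mat[of _ m m _ m _ n]) simp_all
  then have "sqrt (weight e) * (transition_mat ^\<^sub>m Suc k * right_mat) $$ (e, j) =
      sqrt (weight e) * (\<Sum>f<m. transition_mat $$ (e, f) * ?X $$ (f, j))"
    using index_mult_mat_sum[OF carriers(4) X Suc.prems assms(2)] by simp
  \<comment> \<open>The leading square root and the one in the entry of \<open>V\<close> combine to
    \<open>weight e\<close>; the remaining \<open>sqrt (weight f)\<close> is the factor that the
    induction hypothesis for \<open>f\<close> requires.\<close>
  also have "\<dots> = (\<Sum>f<m. if f \<in> ?S then weight e * (sqrt (weight f) * ?X $$ (f, j)) else 0)"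
    unfolding sum_distrib_left using Suc.prems weight_pos[OF e]
    by (intro sum.cong) (auto simp: transition_mat_index arcs_eq simp del: index_mult_mat(1))
  also have "\<dots> = (\<Sum>f<m. if f \<in> ?S
      then weight e * (\<Sum>p\<in>nbt_walks_via G k f j. walk_weight A p) else 0)"
    using Suc.IH by (intro sum.cong) auto
  also have "\<dots> = (\<Sum>f\<in>?S. weight e * (\<Sum>p\<in>nbt_walks_via G k f j. walk_weight A p))"
    by (rule sum.mono_neutral_cong_right) (auto simp: arcs_eq)
  \<comment> \<open>As \<open>tail G f = head G e\<close>, prefixing \<open>tail G e\<close> adds
    precisely the edge \<open>e\<close> to the walk.\<close>
  also have "\<dots> = (\<Sum>f\<in>?S. \<Sum>p\<in>(#) (tail G e) ` nbt_walks_via G k f j. walk_weight A p)"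
  proof (intro sum.cong refl)
    fix f assume f: "f \<in> ?S"
    have "(\<Sum>p\<in>(#) (tail G e) ` nbt_walks_via G k f j. walk_weight A p) =
        (\<Sum>p\<in>nbt_walks_via G k f j. walk_weight A (tail G e # p))"
      by (subst sum.reindex) auto
    also have "\<dots> = (\<Sum>p\<in>nbt_walks_via G k f j. weight e * walk_weight A p)"
      using f by (intro sum.cong) (auto simp: in_nbt_walks_via_iff walk_weight_def)
    finally show "weight e * (\<Sum>p\<in>nbt_walks_via G k f j. walk_weight A p) =
        (\<Sum>p\<in>(#) (tail G e) ` nbt_walks_via G k f j. walk_weight A p)"
      by (simp add: sum_distrib_left)
  qed
  also have "\<dots> = (\<Sum>p\<in>nbt_walks_via G (Suc k) e j. walk_weight A p)"
    unfolding nbt_walks_via_Suc[OF e] using nbt_walks_via_disjoint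
    by (intro sum.UNION_disjoint[symmetric]) (auto simp: finite_nbt_walks_via, blast)
  finally show ?case .
qed

text \<open>Row \<open>i\<close> of \<open>left_mat\<close> selects the edges leaving
  \<open>i\<close> and supplies the factor \<open>sqrt (weight e)\<close> that completes the weights
  of the walks through \<open>e\<close>.\<close>

lemma nbt_walk_mat_Suc:
  "nbt_walk_mat G A (Suc k) = left_mat * transition_mat ^\<^sub>m k * right_mat"
proof -
  let ?X = "transition_mat ^\<^sub>m k * right_mat"
  have X: "?X \<in> carrier_mat m n"
    by (rule mult_carrier_mat[of _ m m]) simp_all
  have "nbt_walk_mat G A (Suc k) $$ (i, j) = (left_mat * ?X) $$ (i, j)" if ij: "i < n" "j < n" for i j
  proof -
    let ?S = "{e \<in> arcs G. tail G e = i}"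
    have "nbt_walk_mat G A (Suc k) $$ (i, j) = (\<Sum>p\<in>nbt_walks G (Suc k) i j. walk_weight A p)"
      using ij by (simp add: nbt_walk_mat_def verts_eq)
    also have "\<dots> = (\<Sum>e\<in>?S. \<Sum>p\<in>nbt_walks_via G k e j. walk_weight A p)"
      unfolding nbt_walks_Suc using nbt_walks_via_disjoint
      by (intro sum.UNION_disjoint) (auto simp: finite_nbt_walks_via)
    also have "\<dots> = (\<Sum>e\<in>?S. sqrt (weight e) * ?X $$ (e, j))"
      using ij by (intro sum.cong refl transition_pow_mult_right_mat[symmetric]) (auto simp: arcs_eq)
    also have "\<dots> = (\<Sum>e<m. left_mat $$ (i, e) * ?X $$ (e, j))"
      using ij by (intro sum.mono_neutral_cong_left)
        (auto simp: arcs_eq left_mat_index simp del: index_mult_mat(1))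
    also have "\<dots> = (left_mat * ?X) $$ (i, j)"
      using index_mult_mat_sum[OF left_right_carriers(1) X ij] by simp
    finally show ?thesis .
  qed
  then have "nbt_walk_mat G A (Suc k) = left_mat * ?X"
    using X by (intro eq_matI) (auto simp del: index_mult_mat(1))
  also have "\<dots> = left_mat * transition_mat ^\<^sub>m k * right_mat"
    by (rule assoc_mult_mat[of _ n m _ m _ n, symmetric]) simp_all
  finally show ?thesis .
qed

section \<open>Summation of the series\<close>

text \<open>The exponent of \<open>V\<close> is one less than the walk length. So one factor
  \<open>t\<close> stays in front while the others enter the power of \<open>tV\<close>, and the
  coefficients are those of \<partial>f.\<close>

lemma nbt_terms_Suc:
  fixes t :: "'a::real_normed_field"
  shows "nbt_terms G A c t (Suc k) =
    t \<cdot>\<^sub>m (map_mat of_real left_mat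
      * shifted_terms c (t \<cdot>\<^sub>m map_mat of_real transition_mat) k
      * map_mat of_real right_mat)"
proof -
  let ?h = "map_mat (of_real :: real \<Rightarrow> 'a)"
  let ?P = "?h left_mat" and ?Q = "?h right_mat" and ?W = "?h (transition_mat ^\<^sub>m k)"
  have PWQ: "?P \<in> carrier_mat n m" "?Q \<in> carrier_mat m n" "?W \<in> carrier_mat m m"
    by simp_all
  have PW: "?P * ?W \<in> carrier_mat n m"
    using PWQ by (intro mult_carrier_mat)
  have "shifted_terms c (t \<cdot>\<^sub>m ?h transition_mat) k = (of_real (c (Suc k)) * t ^ k) \<cdot>\<^sub>m ?W"
    unfolding shifted_terms_def
    by (subst smult_pow_mat[of _ m], simp, subst of_real_hom.mat_hom_pow[of _ m], simp)
      (intro eq_matI, auto simp: mult_ac)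
  then have "?P * shifted_terms c (t \<cdot>\<^sub>m ?h transition_mat) k * ?Q =
      (of_real (c (Suc k)) * t ^ k) \<cdot>\<^sub>m (?P * ?W * ?Q)"
    by (simp only: mult_smult_distrib[OF PWQ(1,3)] mult_smult_assoc_mat[OF PW PWQ(2)])
  also have "?P * ?W * ?Q = ?h (nbt_walk_mat G A (Suc k))"
    unfolding nbt_walk_mat_Suc
    by (subst of_real_hom.mat_hom_mult[of _ n m _ n], (auto intro!: mult_carrier_mat[of _ _ m])[2],
        subst of_real_hom.mat_hom_mult[of left_mat n m _ m]) simp_all
  finally show ?thesis
    by (intro eq_matI) (auto simp: nbt_terms_def mult_ac)
qed

lemma nbt_terms_sums:
  fixes t :: "'a::{real_normed_field, banach}"
  assumes sm: "mat_summable m m (shifted_terms c (t \<cdot>\<^sub>m map_mat of_real transition_mat))"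
    and ij: "i < n" "j < n"
  shows "(\<lambda>k. nbt_terms G A c t k $$ (i, j)) sums
    (of_real (c 0) \<cdot>\<^sub>m 1\<^sub>m n +
      t \<cdot>\<^sub>m (map_mat of_real left_mat
        * shifted_fun c (t \<cdot>\<^sub>m map_mat of_real transition_mat)
        * map_mat of_real right_mat)) $$ (i, j)"
proof -
  let ?h = "map_mat (of_real :: real \<Rightarrow> 'a)"
  let ?F = "shifted_terms c (t \<cdot>\<^sub>m ?h transition_mat)"
  let ?M = "?h left_mat * mat_suminf m m ?F * ?h right_mat"
  have P: "?h left_mat \<in> carrier_mat n m" and Q: "?h right_mat \<in> carrier_mat m n"
    and F: "\<And>k. ?F k \<in> carrier_mat m m"
    by (simp_all add: shifted_terms_def)
  have sf: "shifted_fun c (t \<cdot>\<^sub>m ?h transition_mat) = mat_suminf m m ?F"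
    by (simp add: shifted_fun_def)
  have M: "?M \<in> carrier_mat n n"
    using P Q by (auto simp: mat_suminf_def)
  have "nbt_terms G A c t (Suc k) $$ (i, j) = t * (?h left_mat * ?F k * ?h right_mat) $$ (i, j)" for k
    unfolding nbt_terms_Suc using ij P Q by (subst index_smult_mat) auto
  then have "(\<lambda>k. nbt_terms G A c t (Suc k) $$ (i, j)) sums (t * ?M $$ (i, j))"
    using sums_mult[OF sums_mat_suminf_sandwich[OF P Q F sm ij]] by simp
  then have "(\<lambda>k. nbt_terms G A c t k $$ (i, j)) sums
      (t * ?M $$ (i, j) + nbt_terms G A c t 0 $$ (i, j))"
    by (rule sums_Suc)
  \<comment> \<open>Walks of length 0 are single nodes, so the term at index 0 is \<open>c 0\<close>
    times the identity, also for \<open>t = 0\<close>.\<close>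
  moreover have "t * ?M $$ (i, j) + nbt_terms G A c t 0 $$ (i, j) =
      (of_real (c 0) \<cdot>\<^sub>m 1\<^sub>m n + t \<cdot>\<^sub>m ?M) $$ (i, j)"
    using ij M by (simp add: nbt_terms_def nbt_walk_mat_0[OF verts_eq] del: index_mult_mat(1))
  ultimately show ?thesis
    by (simp only: sf)
qed

text \<open>Every edge ends at exactly one node, so each row of \<open>target_mat G\<close> contains
  a single 1 and the matrix maps ones to ones. This removes \<open>R\<close> from the vector
  identity.\<close>

lemma right_mat_mult_ones:
  "map_mat of_real right_mat *\<^sub>v ones_vec n =
    (map_mat of_real (sqrt_mat (edge_weight_mat G A)) *\<^sub>v ones_vec m :: 'a::real_normed_field Matrix.vec)"
proof -
  let ?h = "map_mat (of_real :: real \<Rightarrow> 'a)"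
  have ones: "ones_vec n \<in> carrier_vec n"
    by (simp add: ones_vec_def)
  have "?h (target_mat G) *\<^sub>v ones_vec n = ones_vec m"
    using head_less
    by (intro eq_vecI)
      (auto simp: ones_vec_def target_mat_def verts_eq arcs_eq scalar_prod_def if_distrib[of of_real]
        cong: if_cong)
  then show ?thesis
    using assoc_mult_mat_vec[of "?h (sqrt_mat (edge_weight_mat G A))" m m "?h (target_mat G)" n "ones_vec n"] ones
    by (simp add: of_real_hom.mat_hom_mult[of _ m m _ n])
qed

end

section \<open>The matrix and vector identities\<close>

text \<open>The scalar type admits real and complex \<open>t\<close>, with real matrices embedded
  entrywise. Summability of both series is part of the conclusion because \<open>suminf\<close> also
  assigns a value to divergent series.\<close>

theorem theorem4p6:
  fixes G :: "(nat, nat) pre_digraph"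
    and n m :: nat
    and A L R Z V :: "real mat"
    and c :: "nat \<Rightarrow> real"
    and r :: ereal
    and t :: "'a::{real_normed_field, banach}"
  assumes "digraph G"
    and "verts G = {..<n}"
    and "arcs G = {..<m}"
    and "A \<in> carrier_mat n n"
    and "\<And>i j. i < n \<Longrightarrow> j < n \<Longrightarrow> (i, j) \<in> arcs_ends G \<Longrightarrow> A $$ (i, j) > 0"
    and "\<And>i j. i < n \<Longrightarrow> j < n \<Longrightarrow> (i, j) \<notin> arcs_ends G \<Longrightarrow> A $$ (i, j) = 0"
    and "L = source_mat G"
    and "R = target_mat G"
    and "Z = edge_weight_mat G A"
    and "V = sqrt_mat (hashimoto_mat G A)"
    and "\<And>k. c k \<ge> 0"
    and "r = conv_radius c"
    and "ereal (norm t) < r / ereal (real_spectral_radius V)"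
  shows "mat_summable n n (nbt_terms G A c t) \<and>
         mat_summable m m (shifted_terms c (t \<cdot>\<^sub>m map_mat of_real V)) \<and>
         mat_suminf n n (nbt_terms G A c t) =
           of_real (c 0) \<cdot>\<^sub>m 1\<^sub>m n +
           t \<cdot>\<^sub>m (map_mat of_real (L\<^sup>T * sqrt_mat Z)
                * shifted_fun c (t \<cdot>\<^sub>m map_mat of_real V)
                * map_mat of_real (sqrt_mat Z * R)) \<and>
         nbt_centrality G A c t =
           of_real (c 0) \<cdot>\<^sub>v ones_vec n +
           t \<cdot>\<^sub>v (map_mat of_real (L\<^sup>T * sqrt_mat Z)
                *\<^sub>v (shifted_fun c (t \<cdot>\<^sub>m map_mat of_real V)
                *\<^sub>v (map_mat of_real (sqrt_mat Z) *\<^sub>v ones_vec m)))"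
proof -
  interpret digraph G by fact
  interpret weighted_digraph G n m A
  proof
    fix e assume "e \<in> arcs G"
    then show "A $$ (tail G e, head G e) > 0"
      using assms(2,5) tail_in_verts[of e] head_in_verts[of e] by (auto simp: arcs_ends_conv)
  qed fact+
  let ?h = "map_mat (of_real :: real \<Rightarrow> 'a)"
  let ?P = "?h (L\<^sup>T * sqrt_mat Z)" and ?Q = "?h (sqrt_mat Z * R)"
    and ?D = "shifted_fun c (t \<cdot>\<^sub>m ?h V)"
  have V: "V \<in> carrier_mat m m"
    using assms(10) by simp
  have P: "?P \<in> carrier_mat n m" and Q: "?Q \<in> carrier_mat m n"
    using left_right_carriers assms(7-9) by simp_all
  have D: "?D \<in> carrier_mat m m"
    using V by (simp add: shifted_fun_def mat_suminf_def)
  let ?M = "of_real (c 0) \<cdot>\<^sub>m 1\<^sub>m n + t \<cdot>\<^sub>m (?P * ?D * ?Q)"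
  have sm: "mat_summable m m (shifted_terms c (t \<cdot>\<^sub>m ?h V))"
    using assms(12,13) by (intro mat_summable_shifted_terms[OF V]) simp
  have sums: "(\<lambda>k. nbt_terms G A c t k $$ (i, j)) sums ?M $$ (i, j)" if "i < n" "j < n" for i j
    using nbt_terms_sums[of c t i j] sm that assms(7-10) by simp
  have PDQ: "?P * ?D * ?Q \<in> carrier_mat n n"
    using P D Q by (intro mult_carrier_mat)
  have M: "?M \<in> carrier_mat n n"
    using PDQ by simp
  have eq: "mat_suminf n n (nbt_terms G A c t) = ?M"
    using sums carrier_matD[OF M] by (intro eq_matI) (simp_all only: mat_suminf_def sums_iff
        dim_row_mat dim_col_mat index_mat prod.case)
  have ones: "(ones_vec n :: 'a Matrix.vec) \<in> carrier_vec n"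
    by (simp add: ones_vec_def)
  have smult_vec: "(a \<cdot>\<^sub>m X) *\<^sub>v ones_vec n = a \<cdot>\<^sub>v (X *\<^sub>v ones_vec n)"
    if "X \<in> carrier_mat n n" for a :: 'a and X
    using that ones by (intro eq_vecI) auto
  have "nbt_centrality G A c t = ?M *\<^sub>v ones_vec n"
    by (simp add: nbt_centrality_def verts_eq eq)
  also have "\<dots> = of_real (c 0) \<cdot>\<^sub>v ones_vec n + t \<cdot>\<^sub>v ((?P * ?D * ?Q) *\<^sub>v ones_vec n)"
    using PDQ ones by (subst add_mult_distrib_mat_vec[of _ n n]) (auto simp: smult_vec)
  also have "(?P * ?D * ?Q) *\<^sub>v ones_vec n = ?P *\<^sub>v (?D *\<^sub>v (?Q *\<^sub>v ones_vec n))"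
    using P D Q ones
    by (simp add: assoc_mult_mat_vec[of _ n m _ n] assoc_mult_mat_vec[of _ n m _ m]
        mult_carrier_mat[of _ n m] mult_mat_vec_carrier[of _ m n])
  also have "?Q *\<^sub>v ones_vec n = ?h (sqrt_mat Z) *\<^sub>v ones_vec m"
    using right_mat_mult_ones assms(8,9) by simp
  finally show ?thesis
    using sums sm eq by (auto simp: mat_summable_def sums_iff simp del: index_mult_mat(1) index_add_mat(1))
qed

end
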